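(* Let $R>0$, $\mu\in\mathbb{R}$, and let $f\in C_c^\infty(D_R)$. For $n\in\mathbb{Z}$ let $f_n$ and $g_n$ denote the angular Fourier coefficients of $f$ and of the attenuated V-line transform $\mathcal{V}_\mu f$, respectively, and set \begin{itemize} \item $\hat g_n(t):=\tfrac12\,e^{\mu R\sqrt{t}}\,g_n(\arccos(\sqrt{t}))$; \item $\hat f_n(\rho):=R\,f_n(R\sqrt{1-\rho})$; \item $\hat K_n(t,\rho):=\tfrac12\sum_{\sigma=\pm1}\sigma^n\,e^{\sigma\mu R\sqrt{t-\rho}}\;T_n\Bigl(\frac{\sqrt{t}\sqrt{t-\rho}+\sigma(1-t)}{\sqrt{1-\rho}}\Bigr)$. \end{itemize} Then for all $n\in\mathbb{Z}$ and all $t\in[0,1]$, $$\hat g_n(t)=\int_0^t\hat f_n(\rho)\,\frac{\hat K_n(t,\rho)}{\sqrt{t-\rho}}\,\mathrm{d}\rho .$$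
   Context: $D_R:=\{x\in\mathbb{R}^2 : \|x\|<R\}$ is the open disc of radius $R$, and $C_c^\infty(D_R)$ is the set of all smooth functions $f:\mathbb{R}^2\to\mathbb{R}$ with $\operatorname{supp}(f)\subseteq D_R$. For $\varphi\in\mathbb{R}$, $\Phi(\varphi):=(\cos\varphi,\sin\varphi)$. The attenuated V-line transform of $f\in C_c^\infty(D_R)$ with attenuation parameter $\mu\in\mathbb{R}$ is $$\mathcal{V}_\mu f(\varphi,\psi):=\sum_{\sigma=\pm1}\int_0^\infty f\bigl(R\,\Phi(\varphi)-r\,\Phi(\varphi-\sigma\psi)\bigr)\,e^{-\mu r}\,\mathrm{d}r,$$ for $\varphi\in[0,2\pi)$ and $\psi\in(0,\pi/2)$; at the endpoints $\psi\in\{0,\pi/2\}$ it is defined by the same formula. The Fourier coefficients are (with $\mathsf{i}$ the imaginary unit) $$f_n(r):=\frac{1}{2\pi}\int_0^{2\pi}f(r\Phi(\varphi))\,e^{-\mathsf{i}n\varphi}\,\mathrm{d}\varphi,\qquad g_n(\psi):=\frac{1}{2\pi}\int_0^{2\pi}(\mathcal{V}_\mu f)(\varphi,\psi)\,e^{-\mathsf{i}n\varphi}\,\mathrm{d}\varphi.$$ $T_k(z):=\cos(k\arccos(z))$ for $|z|\le1$, $k\in\mathbb{Z}$, denotes the Chebyshev polynomial of the first kind (so $T_{-k}=T_k$). *)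

theory Defs
  imports "HOL-Analysis.Analysis"
begin

text \<open>For \<open>k > 0\<close> the condition in all directions \<open>v\<close> is equivalent to the one on the partial derivatives,
  as the derivative is linear in \<open>v\<close>.\<close>

fun Ck_everywhere :: "nat \<Rightarrow> ('a::euclidean_space \<Rightarrow> real) \<Rightarrow> bool" where
  "Ck_everywhere 0 f \<longleftrightarrow> continuous_on UNIV f"
| "Ck_everywhere (Suc k) f \<longleftrightarrow>
     (\<forall>x. f differentiable (at x)) \<and>
     (\<forall>v. Ck_everywhere k (\<lambda>x. frechet_derivative f (at x) v))"

definition smooth :: "('a::euclidean_space \<Rightarrow> real) \<Rightarrow> bool" where
  "smooth f \<longleftrightarrow> (\<forall>k. Ck_everywhere k f)"

text \<open>The support is the closure of the non-vanishing set, so that its inclusion in the open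
  (bounded) disc already forces it to be compact.\<close>

definition Cc_infinity_disc :: "real \<Rightarrow> (real ^ 2 \<Rightarrow> real) set" where
  "Cc_infinity_disc R = {f. smooth f \<and> closure {x. f x \<noteq> 0} \<subseteq> ball 0 R}"

definition unit_dir :: "real \<Rightarrow> real ^ 2" where
  "unit_dir \<phi> = vector [cos \<phi>, sin \<phi>]"

definition vline_transform ::
  "real \<Rightarrow> real \<Rightarrow> (real ^ 2 \<Rightarrow> real) \<Rightarrow> real \<Rightarrow> real \<Rightarrow> real" where
  "vline_transform R \<mu> f \<phi> \<psi> =
     (\<Sum>\<sigma>\<in>{-1, 1}. LBINT r:{0..}.
        f (R *\<^sub>R unit_dir \<phi> - r *\<^sub>R unit_dir (\<phi> - \<sigma> * \<psi>)) * exp (- \<mu> * r))"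

definition fourier_coeff :: "(real \<Rightarrow> real) \<Rightarrow> int \<Rightarrow> complex" where
  "fourier_coeff h n =
     1 / (2 * of_real pi) *
     (CLBINT \<phi>:{0..2 * pi}. of_real (h \<phi>) * exp (- \<i> * of_int n * of_real \<phi>))"

definition f_coeff :: "(real ^ 2 \<Rightarrow> real) \<Rightarrow> int \<Rightarrow> real \<Rightarrow> complex" where
  "f_coeff f n r = fourier_coeff (\<lambda>\<phi>. f (r *\<^sub>R unit_dir \<phi>)) n"

definition g_coeff ::
  "real \<Rightarrow> real \<Rightarrow> (real ^ 2 \<Rightarrow> real) \<Rightarrow> int \<Rightarrow> real \<Rightarrow> complex" where
  "g_coeff R \<mu> f n \<psi> = fourier_coeff (\<lambda>\<phi>. vline_transform R \<mu> f \<phi> \<psi>) n"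

text \<open>Meaningful for \<open>\<bar>z\<bar> \<le> 1\<close> only.\<close>

definition chebyshev_T :: "int \<Rightarrow> real \<Rightarrow> real" where
  "chebyshev_T k z = cos (of_int k * arccos z)"

definition g_hat ::
  "real \<Rightarrow> real \<Rightarrow> (real ^ 2 \<Rightarrow> real) \<Rightarrow> int \<Rightarrow> real \<Rightarrow> complex" where
  "g_hat R \<mu> f n t =
     1 / 2 * of_real (exp (\<mu> * R * sqrt t)) * g_coeff R \<mu> f n (arccos (sqrt t))"

definition f_hat :: "real \<Rightarrow> (real ^ 2 \<Rightarrow> real) \<Rightarrow> int \<Rightarrow> real \<Rightarrow> complex" where
  "f_hat R f n \<rho> = of_real R * f_coeff f n (R * sqrt (1 - \<rho>))"

text \<open>For \<open>0 \<le> \<rho> \<le> t \<le> 1\<close> with \<open>\<rho> < 1\<close> the argument of the Chebyshev polynomial lies in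
  \<open>[-1, 1]\<close>; the totalised value at \<open>t = \<rho> = 1\<close> is irrelevant under the integral.\<close>

definition K_hat :: "real \<Rightarrow> real \<Rightarrow> int \<Rightarrow> real \<Rightarrow> real \<Rightarrow> real" where
  "K_hat R \<mu> n t \<rho> =
     1 / 2 * (\<Sum>\<sigma>\<in>{-1, 1}. \<sigma> powi n * exp (\<sigma> * \<mu> * R * sqrt (t - \<rho>)) *
       chebyshev_T n ((sqrt t * sqrt (t - \<rho>) + \<sigma> * (1 - t)) / sqrt (1 - \<rho>)))"

end

theory Submission
  imports Defs
begin

text \<open>
  Why the formula holds. Put \<open>s = sqrt t = cos \<psi>\<close>. The ray of sign \<open>\<sigma>\<close> from the boundary point
  \<open>R \<Phi>(\<phi>)\<close> meets the disc in a chord of length \<open>2 R s\<close>, so its parameter \<open>r\<close> may be restricted to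
  \<open>[0, 2 R s]\<close>. The point with parameter \<open>r\<close> on it has polar coordinates
  \<open>(d(r), \<phi> + \<sigma> \<alpha>(r))\<close>, where \<open>d\<close> and \<open>\<alpha>\<close> depend neither on \<open>\<phi>\<close> nor on \<open>\<sigma>\<close>
  (lemma \<open>vline_point_polar\<close>). The two rays are thus mirror images in the diameter through
  \<open>R \<Phi>(\<phi>)\<close>, and the transform commutes with rotations. Exchanging the integrals over \<open>\<phi>\<close> and \<open>r\<close>,
  each \<open>r\<close> contributes the \<open>n\<close>-th coefficient of a rotated circle function, that is
  \<open>exp (\<i> n \<sigma> \<alpha>(r)) f\<^sub>n(d(r))\<close>; the sum over \<open>\<sigma>\<close> turns the phases into
  a cosine (lemma \<open>g_coeff_eq_chord_integral\<close>):
  \<open>g\<^sub>n(\<psi>) = 2 \<integral> exp (- \<mu> r) cos (n \<alpha>(r)) f\<^sub>n(d(r)) dr\<close> over \<open>0 \<le> r \<le> 2 R s\<close>.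

  The distance \<open>d\<close> decreases up to the midpoint \<open>r = R s\<close> of the chord and then increases
  symmetrically. On either half \<open>\<rho> = 1 - (d / R)\<^sup>2\<close> is an admissible variable: it runs over \<open>(0, t)\<close>, and
  \<open>r = R (s - \<sigma> sqrt (t - \<rho>))\<close>, where now \<open>\<sigma>\<close> labels the half. The Jacobian \<open>R / (2 sqrt (t - \<rho>))\<close> is the
  weakly singular factor of the Abel kernel (lemma \<open>chord_substitution\<close>). Expressing \<open>cos \<alpha>\<close>
  through \<open>\<rho>\<close> gives \<open>\<sigma>\<close> times the argument of the Chebyshev polynomial, whose parity yields the
  factor \<open>\<sigma>\<^sup>n\<close> (lemma \<open>chord_integrand_substituted\<close>).
\<close>

section \<open>Integration of continuous functions on the line and the plane\<close>

lemma interval_integral_translate: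
  fixes F :: "real \<Rightarrow> 'a::{banach, second_countable_topology}" and a b c :: real
  shows "(LBINT x=a+c..b+c. F x) = (LBINT x=a..b. F (x + c))"
proof -
  have "(LBINT x:{u+c<..<v+c}. F x) = (LBINT x:{u<..<v}. F (x + c))" for u v :: real
    unfolding set_lebesgue_integral_def
    by (subst lborel_integral_real_affine[where c=1 and t=c])
       (auto intro!: Bochner_Integration.integral_cong simp: indicator_def add.commute)
  then show ?thesis
    by (simp add: interval_lebesgue_integral_def del: plus_ereal.simps)
qed

text \<open>Shifting the window \<open>[0, p]\<close> by \<open>a\<close> adds a piece at one end and removes its translate by \<open>p\<close> at
  the other. With oriented integrals this needs no case distinction on the sign or size of \<open>a\<close>.\<close>

lemma periodic_set_integral_translate:
  fixes F :: "real \<Rightarrow> 'a::euclidean_space" and a p :: real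
  assumes cont: "continuous_on UNIV F" and per: "\<And>x. F (x + p) = F x" and p: "p \<ge> 0"
  shows "(LBINT x:{0..p}. F (x + a)) = (LBINT x:{0..p}. F x)"
proof -
  let ?J = "\<lambda>(u::real) (v::real). LBINT x=u..v. F x"
  have integrable: "interval_lebesgue_integrable lborel (ereal u) (ereal v) F" for u v
    using cont by (intro interval_integrable_isCont) (auto simp: continuous_on_eq_continuous_at)
  have split: "?J u v + ?J v w = ?J u w" for u v w
    using integrable[of "min u (min v w)" "max u (max v w)"] by (intro interval_integral_sum) simp
  have "?J (0+a) (p+a) = ?J a 0 + ?J 0 p + ?J p (p+a)"
    by (simp add: split)
  also have "?J p (p+a) = ?J 0 a"
    using interval_integral_translate[of 0 p a F] unfolding per by (simp only: add_0 add.commute[of a])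
  also have "?J a 0 = - ?J 0 a"
    by (rule interval_integral_endpoints_reverse)
  finally have "?J (0+a) (p+a) = ?J 0 p" by simp
  then show ?thesis
    unfolding interval_integral_translate using p
    by (metis interval_integral_Icc)
qed

text \<open>A continuous function is integrable over a compact rectangle, so Fubini's theorem applies. Besides
  the exchange it supplies the integrability of both marginal integrals, which is how integrability
  along the chord is obtained further below.\<close>

lemma iterated_integral_swap_continuous:
  fixes F :: "real \<Rightarrow> real \<Rightarrow> 'a::{banach, second_countable_topology}"
  assumes "continuous_on UNIV (\<lambda>(x, y). F x y)"
  shows "set_integrable lborel {a..b} (\<lambda>x. LBINT y:{c..d}. F x y)"
    and "set_integrable lborel {c..d} (\<lambda>y. LBINT x:{a..b}. F x y)"
    and "(LBINT x:{a..b}. LBINT y:{c..d}. F x y) = (LBINT y:{c..d}. LBINT x:{a..b}. F x y)"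
proof -
  let ?G = "\<lambda>x y. indicator {a..b} x *\<^sub>R indicator {c..d} y *\<^sub>R F x y"
  have "integrable lborel (\<lambda>z. indicator ({a..b} \<times> {c..d}) z *\<^sub>R (\<lambda>(x, y). F x y) z)"
    by (rule borel_integrable_compact)
       (auto intro: compact_Times continuous_on_subset[OF assms])
  then have int: "integrable (lborel \<Otimes>\<^sub>M lborel) (case_prod ?G)"
    by (simp add: lborel_prod indicator_times split_beta' ac_simps)
  note P = lborel_pair.integrable_fst[OF int] lborel_pair.integrable_snd[OF int]
    lborel_pair.Fubini_integral[OF int]
  have eq1: "(\<integral>y. ?G x y \<partial>lborel) = indicator {a..b} x *\<^sub>R (LBINT y:{c..d}. F x y)" for x
    unfolding set_lebesgue_integral_def by (simp only: integral_scaleR_right)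
  have eq2: "(\<integral>x. ?G x y \<partial>lborel) = indicator {c..d} y *\<^sub>R (LBINT x:{a..b}. F x y)" for y
    unfolding set_lebesgue_integral_def
    by (simp only: scaleR_left_commute[of "indicator {a..b} _"] integral_scaleR_right)
  show "set_integrable lborel {a..b} (\<lambda>x. LBINT y:{c..d}. F x y)"
    using P(1) by (simp only: eq1 set_integrable_def)
  show "set_integrable lborel {c..d} (\<lambda>y. LBINT x:{a..b}. F x y)"
    using P(2) by (simp only: eq2 set_integrable_def)
  show "(LBINT x:{a..b}. LBINT y:{c..d}. F x y) = (LBINT y:{c..d}. LBINT x:{a..b}. F x y)"
    using P(3) unfolding eq1 eq2 by (simp add: set_lebesgue_integral_def)
qed

section \<open>Rotations and Fourier coefficients\<close>

lemma unit_dir_eq: "unit_dir \<phi> = cos \<phi> *\<^sub>R axis 1 1 + sin \<phi> *\<^sub>R axis 2 1"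
  by (simp add: unit_dir_def vec_eq_iff forall_2 axis_def)

lemma continuous_on_unit_dir [continuous_intros]:
  fixes g :: "'a::t2_space \<Rightarrow> real"
  shows "continuous_on S g \<Longrightarrow> continuous_on S (\<lambda>x. unit_dir (g x))"
  unfolding unit_dir_eq by (intro continuous_intros)

lemma borel_measurable_unit_dir [measurable]: "unit_dir \<in> borel_measurable borel"
  by (intro borel_measurable_continuous_onI continuous_intros)

lemma norm_unit_dir [simp]: "norm (unit_dir \<phi>) = 1"
  by (simp add: unit_dir_def norm_vec_def L2_set_def sum_2)

lemma unit_dir_periodic: "unit_dir (\<phi> + 2 * pi) = unit_dir \<phi>"
  by (simp add: unit_dir_def)

text \<open>A rotation of a function on the circle acts on its \<open>n\<close>-th coefficient by a phase.\<close>

lemma fourier_coeff_translate: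
  assumes cont: "continuous_on UNIV h" and per: "\<And>\<phi>. h (\<phi> + 2 * pi) = h \<phi>"
  shows "fourier_coeff (\<lambda>\<phi>. h (\<phi> + a)) n = exp (\<i> * of_int n * of_real a) * fourier_coeff h n"
proof -
  let ?F = "\<lambda>\<phi>. of_real (h \<phi>) * exp (- \<i> * of_int n * of_real \<phi>)"
  have exp_per: "exp (- \<i> * of_int n * of_real (\<phi> + 2 * pi)) = exp (- \<i> * of_int n * of_real \<phi>)" for \<phi>
  proof -
    have "- \<i> * of_int n * of_real (\<phi> + 2 * pi)
        = - \<i> * of_int n * of_real \<phi> + of_real (2 * of_int (- n) * pi) * \<i>"
      by (simp add: algebra_simps)
    then show ?thesis
      using exp_integer_2pi[OF Ints_of_int, of "- n"] by (simp only: exp_add mult_1_right)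
  qed
  have "(CLBINT \<phi>:{0..2*pi}. ?F (\<phi> + a)) = (CLBINT \<phi>:{0..2*pi}. ?F \<phi>)"
    by (intro periodic_set_integral_translate continuous_intros cont) (simp_all only: per exp_per, simp)
  then have "exp (\<i> * of_int n * of_real a) * (CLBINT \<phi>:{0..2*pi}. ?F \<phi>)
      = (CLBINT \<phi>:{0..2*pi}. exp (\<i> * of_int n * of_real a) * ?F (\<phi> + a))"
    by (simp only: set_integral_mult_right)
  moreover have "exp (\<i> * of_int n * of_real a) * ?F (\<phi> + a)
      = of_real (h (\<phi> + a)) * exp (- \<i> * of_int n * of_real \<phi>)" for \<phi>
    by (simp add: algebra_simps flip: exp_add)
  ultimately show ?thesis
    unfolding fourier_coeff_def by (simp only: mult.left_commute)
qed

section \<open>Polar coordinates along a chord\<close>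

text \<open>By the law of cosines this is the distance to the origin of the point with arc length \<open>r\<close> on a
  ray that starts on the circle of radius \<open>R\<close> and makes an angle with cosine \<open>s\<close> with the inward
  normal.\<close>

definition chord_radius :: "real \<Rightarrow> real \<Rightarrow> real \<Rightarrow> real" where
  "chord_radius R s r = sqrt (R\<^sup>2 - 2 * R * s * r + r\<^sup>2)"

text \<open>This is the angle at the origin between that point and the starting point of the ray. At the
  centre of the disc the quotient is \<open>0 / 0 = 0\<close>; the resulting value \<open>\<pi> / 2\<close> is as good as any other,
  since the radius vanishes there.\<close>

definition chord_angle :: "real \<Rightarrow> real \<Rightarrow> real \<Rightarrow> real" where
  "chord_angle R s r = arccos ((R - s * r) / chord_radius R s r)"

text \<open>The cosine part only needs the quotient in the definition of the angle to lie in \<open>[-1, 1]\<close>. The sine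
  part fixes the branch: \<open>arccos\<close> returns an angle with nonnegative sine, and \<open>r sin \<psi>\<close> is nonnegative
  too, so equality of the squares is enough.\<close>

lemma chord_polar:
  assumes \<psi>: "0 \<le> \<psi>" "\<psi> \<le> pi" and r: "0 \<le> r"
  shows "chord_radius R (cos \<psi>) r * cos (chord_angle R (cos \<psi>) r) = R - r * cos \<psi>"
    and "chord_radius R (cos \<psi>) r * sin (chord_angle R (cos \<psi>) r) = r * sin \<psi>"
proof -
  define \<rho> where "\<rho> = chord_radius R (cos \<psi>) r"
  define c where "c = (R - cos \<psi> * r) / \<rho>"
  have sq: "R\<^sup>2 - 2 * R * cos \<psi> * r + r\<^sup>2 = (R - cos \<psi> * r)\<^sup>2 + (r * sin \<psi>)\<^sup>2"
    unfolding power_mult_distrib sin_squared_eq by (simp add: power2_eq_square algebra_simps)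
  have \<rho>: "\<rho>\<^sup>2 = (R - cos \<psi> * r)\<^sup>2 + (r * sin \<psi>)\<^sup>2" and \<rho>0: "\<rho> \<ge> 0"
    by (simp_all add: \<rho>_def chord_radius_def sq)
  have rs: "r * sin \<psi> \<ge> 0" using r \<psi> by (simp add: sin_ge_zero)
  have "\<bar>R - cos \<psi> * r\<bar> \<le> \<rho>"
    using \<rho> \<rho>0 by (intro abs_le_square_iff[THEN iffD2, of _ \<rho>, simplified abs_of_nonneg[OF \<rho>0]]) simp
  then have c: "- 1 \<le> c" "c \<le> 1" "\<rho> * c = R - cos \<psi> * r"
    using \<rho>0 by (auto simp: c_def divide_simps abs_le_iff)
  show "chord_radius R (cos \<psi>) r * cos (chord_angle R (cos \<psi>) r) = R - r * cos \<psi>"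
    using c by (simp add: chord_angle_def flip: \<rho>_def c_def)
  have "(\<rho> * sqrt (1 - c\<^sup>2))\<^sup>2 = \<rho>\<^sup>2 - (\<rho> * c)\<^sup>2"
    using c by (simp add: power_mult_distrib abs_square_le_1 abs_le_iff algebra_simps)
  also have "\<dots> = (r * sin \<psi>)\<^sup>2" by (simp add: c \<rho>)
  finally have "\<rho> * sqrt (1 - c\<^sup>2) = r * sin \<psi>"
    using \<rho>0 rs c by (simp add: power2_eq_iff_nonneg abs_square_le_1 abs_le_iff)
  then show "chord_radius R (cos \<psi>) r * sin (chord_angle R (cos \<psi>) r) = r * sin \<psi>"
    using c by (simp add: chord_angle_def sin_arccos flip: \<rho>_def c_def)
qed

text \<open>This is where rotation invariance and the mirror symmetry of the two branches of the V
  become visible: \<open>\<phi>\<close> and \<open>\<sigma>\<close> enter through the polar angle alone, in the form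
  \<open>\<phi> + \<sigma> \<alpha>\<close>.\<close>

lemma vline_point_polar:
  assumes "\<sigma> \<in> {-1, 1}" "0 \<le> \<psi>" "\<psi> \<le> pi" "0 \<le> r"
  shows "R *\<^sub>R unit_dir \<phi> - r *\<^sub>R unit_dir (\<phi> - \<sigma> * \<psi>)
       = chord_radius R (cos \<psi>) r *\<^sub>R unit_dir (\<phi> + \<sigma> * chord_angle R (cos \<psi>) r)"
proof -
  let ?\<rho> = "chord_radius R (cos \<psi>) r" and ?\<alpha> = "chord_angle R (cos \<psi>) r"
  note P = chord_polar[OF assms(2-4), of R]
  have "?\<rho> * cos (\<phi> + \<sigma> * ?\<alpha>) = cos \<phi> * (?\<rho> * cos ?\<alpha>) - \<sigma> * sin \<phi> * (?\<rho> * sin ?\<alpha>)"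
    "?\<rho> * sin (\<phi> + \<sigma> * ?\<alpha>) = sin \<phi> * (?\<rho> * cos ?\<alpha>) + \<sigma> * cos \<phi> * (?\<rho> * sin ?\<alpha>)"
    using assms(1) by (auto simp: cos_add sin_add cos_diff sin_diff algebra_simps)
  then show ?thesis
    unfolding P using assms(1)
    by (auto simp: unit_dir_def vec_eq_iff forall_2 cos_add sin_add cos_diff sin_diff algebra_simps)
qed

section \<open>Fourier coefficients of the V-line transform\<close>

text \<open>Beyond the length \<open>2 R cos \<psi>\<close> of the chord, the ray has left the disc.\<close>

lemma vline_transform_eq_chord:
  assumes R: "0 \<le> R" and supp: "\<And>x. R \<le> norm x \<Longrightarrow> f x = 0"
    and \<psi>: "0 \<le> \<psi>" "\<psi> \<le> pi"
  shows "vline_transform R \<mu> f \<phi> \<psi> = (\<Sum>\<sigma>\<in>{-1, 1}. LBINT r:{0..2 * R * cos \<psi>}.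
        f (R *\<^sub>R unit_dir \<phi> - r *\<^sub>R unit_dir (\<phi> - \<sigma> * \<psi>)) * exp (- \<mu> * r))"
  unfolding vline_transform_def
proof (rule sum.cong[OF refl])
  fix \<sigma> :: real assume \<sigma>: "\<sigma> \<in> {-1, 1}"
  let ?p = "\<lambda>r. R *\<^sub>R unit_dir \<phi> - r *\<^sub>R unit_dir (\<phi> - \<sigma> * \<psi>)"
  have zero: "f (?p r) = 0" if r: "0 \<le> r" "2 * R * cos \<psi> < r" for r
  proof (rule supp)
    have "r * (2 * R * cos \<psi>) \<le> r * r"
      using r by (intro mult_left_mono) auto
    then have "R \<le> chord_radius R (cos \<psi>) r"
      unfolding chord_radius_def by (intro real_le_rsqrt) (simp add: power2_eq_square algebra_simps)
    then show "R \<le> norm (?p r)"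
      using R by (simp add: vline_point_polar[OF \<sigma> \<psi> r(1)])
  qed
  show "(LBINT r:{0..}. f (?p r) * exp (- \<mu> * r))
      = (LBINT r:{0..2 * R * cos \<psi>}. f (?p r) * exp (- \<mu> * r))"
    unfolding set_lebesgue_integral_def
  proof (intro Bochner_Integration.integral_cong refl)
    fix r :: real
    consider "r < 0" | "0 \<le> r" "r \<le> 2 * R * cos \<psi>" | "0 \<le> r" "2 * R * cos \<psi> < r"
      by linarith
    then show "indicat_real {0..} r *\<^sub>R (f (?p r) * exp (- \<mu> * r))
        = indicat_real {0..2 * R * cos \<psi>} r *\<^sub>R (f (?p r) * exp (- \<mu> * r))"
      by cases (simp_all only: zero indicator_simps atLeastAtMost_iff atLeast_iff, simp_all)
  qed
qed

text \<open>The common contribution of the two mirror-symmetric points at arc length \<open>r\<close> to the \<open>n\<close>-th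
  coefficient, up to the factor \<open>2\<close>: their phases \<open>exp (\<plusminus> \<i> n \<alpha>)\<close> have mean \<open>cos (n \<alpha>)\<close>.\<close>

definition chord_integrand ::
  "real \<Rightarrow> real \<Rightarrow> (real ^ 2 \<Rightarrow> real) \<Rightarrow> int \<Rightarrow> real \<Rightarrow> real \<Rightarrow> complex" where
  "chord_integrand R \<mu> f n s r =
     of_real (exp (- \<mu> * r) * cos (of_int n * chord_angle R s r)) * f_coeff f n (chord_radius R s r)"

text \<open>The exchange of the two integrations makes the angular integral the inner one. For fixed \<open>r\<close> its
  integrand is a rotation of \<open>f\<close> on the circle of radius \<open>chord_radius\<close>, which only contributes
  a phase.\<close>

lemma g_coeff_eq_chord_integral:
  fixes f :: "real ^ 2 \<Rightarrow> real"
  assumes R: "0 \<le> R" and cont: "continuous_on UNIV f"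
    and supp: "\<And>x. R \<le> norm x \<Longrightarrow> f x = 0"
    and \<psi>: "0 \<le> \<psi>" "\<psi> \<le> pi"
  shows "set_integrable lborel {0..2 * R * cos \<psi>} (chord_integrand R \<mu> f n (cos \<psi>))"
    and "g_coeff R \<mu> f n \<psi> = 2 * (CLBINT r:{0..2 * R * cos \<psi>}. chord_integrand R \<mu> f n (cos \<psi>) r)"
proof -
  define H where "H = chord_integrand R \<mu> f n (cos \<psi>)"
  define L where "L = 2 * R * cos \<psi>"
  define F where "F = (\<lambda>\<sigma> \<phi> r. complex_of_real
      (f (R *\<^sub>R unit_dir \<phi> - r *\<^sub>R unit_dir (\<phi> - \<sigma> * \<psi>)) * exp (- \<mu> * r))
      * exp (- \<i> * of_int n * of_real \<phi>))"
  define h where "h = (\<lambda>\<sigma> r. of_real (exp (- \<mu> * r))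
      * exp (\<i> * of_int n * of_real (\<sigma> * chord_angle R (cos \<psi>) r))
      * f_coeff f n (chord_radius R (cos \<psi>) r))"
  have contF: "continuous_on UNIV (\<lambda>(\<phi>, r). F \<sigma> \<phi> r)" for \<sigma>
    unfolding F_def split_beta'
    by (intro continuous_intros continuous_on_compose2[OF cont]) auto
  note swap = iterated_integral_swap_continuous[OF contF]
  have inner: "1 / (2 * of_real pi) * (CLBINT \<phi>:{0..2 * pi}. F \<sigma> \<phi> r) = h \<sigma> r"
    if "\<sigma> \<in> {-1, 1}" "0 \<le> r" for \<sigma> r
  proof -
    let ?k = "\<lambda>\<phi>. f (chord_radius R (cos \<psi>) r *\<^sub>R unit_dir \<phi>)"
    let ?a = "\<sigma> * chord_angle R (cos \<psi>) r"
    have "F \<sigma> \<phi> r = of_real (exp (- \<mu> * r))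
        * (of_real (?k (\<phi> + ?a)) * exp (- \<i> * of_int n * of_real \<phi>))" for \<phi>
      by (simp add: F_def vline_point_polar[OF that(1) \<psi> that(2)])
    then have "1 / (2 * of_real pi) * (CLBINT \<phi>:{0..2 * pi}. F \<sigma> \<phi> r)
        = of_real (exp (- \<mu> * r)) * fourier_coeff (\<lambda>\<phi>. ?k (\<phi> + ?a)) n"
      by (simp add: fourier_coeff_def)
    also have "fourier_coeff (\<lambda>\<phi>. ?k (\<phi> + ?a)) n
        = exp (\<i> * of_int n * of_real ?a) * fourier_coeff ?k n"
      by (intro fourier_coeff_translate continuous_on_compose2[OF cont] continuous_intros)
         (auto simp: unit_dir_periodic)
    finally show ?thesis by (simp add: h_def f_coeff_def)
  qed
  have h_int: "set_integrable lborel {0..L} (h \<sigma>)"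
    and h_eq: "1 / (2 * of_real pi) * (CLBINT \<phi>:{0..2 * pi}. (CLBINT r:{0..L}. F \<sigma> \<phi> r))
             = (CLBINT r:{0..L}. h \<sigma> r)" if "\<sigma> \<in> {-1, 1}" for \<sigma>
  proof -
    have eq: "1 / (2 * of_real pi) * (CLBINT \<phi>:{0..2 * pi}. F \<sigma> \<phi> r) = h \<sigma> r"
      if "r \<in> {0..L}" for r
      using inner[OF \<open>\<sigma> \<in> _\<close>] that by simp
    have "set_integrable lborel {0..L} (\<lambda>r. 1 / (2 * of_real pi) * (CLBINT \<phi>:{0..2 * pi}. F \<sigma> \<phi> r))"
      by (intro set_integrable_mult_right impI swap(2))
    then show "set_integrable lborel {0..L} (h \<sigma>)"
      by (simp only: set_integrable_cong[OF refl refl eq])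
    have "1 / (2 * of_real pi) * (CLBINT \<phi>:{0..2 * pi}. (CLBINT r:{0..L}. F \<sigma> \<phi> r))
        = (CLBINT r:{0..L}. 1 / (2 * of_real pi) * (CLBINT \<phi>:{0..2 * pi}. F \<sigma> \<phi> r))"
      by (simp only: swap(3) set_integral_mult_right)
    also have "\<dots> = (CLBINT r:{0..L}. h \<sigma> r)"
      using eq by (intro set_lebesgue_integral_cong) auto
    finally show "1 / (2 * of_real pi) * (CLBINT \<phi>:{0..2 * pi}. (CLBINT r:{0..L}. F \<sigma> \<phi> r))
             = (CLBINT r:{0..L}. h \<sigma> r)" .
  qed
  have sum_h: "h (-1) r + h 1 r = 2 * H r" for r
  proof -
    have "exp (\<i> * of_int n * of_real (- 1 * a)) + exp (\<i> * of_int n * of_real (1 * a))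
        = 2 * complex_of_real (cos (of_int n * a))" for a
      by (simp add: cos_of_real[symmetric] cos_exp_eq algebra_simps)
    note this[of "chord_angle R (cos \<psi>) r"]
    then show ?thesis
      unfolding h_def H_def chord_integrand_def by (simp only: of_real_mult flip: distrib_left distrib_right) simp
  qed
  have H2: "set_integrable lborel {0..L} (\<lambda>r. 2 * H r)"
    using set_integral_add(1)[OF h_int h_int, of "-1" 1] by (simp add: sum_h)
  show "set_integrable lborel {0..2 * R * cos \<psi>} (chord_integrand R \<mu> f n (cos \<psi>))"
    using H2 unfolding L_def[symmetric] H_def[symmetric] by simp
  have vline: "vline_transform R \<mu> f \<phi> \<psi> = (\<Sum>\<sigma>\<in>{-1, 1}. LBINT r:{0..L}.
        f (R *\<^sub>R unit_dir \<phi> - r *\<^sub>R unit_dir (\<phi> - \<sigma> * \<psi>)) * exp (- \<mu> * r))" for \<phi>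
    unfolding L_def by (rule vline_transform_eq_chord[OF R _ \<psi>]) (rule supp)
  have "of_real (vline_transform R \<mu> f \<phi> \<psi>) * exp (- \<i> * of_int n * of_real \<phi>)
      = (CLBINT r:{0..L}. F (-1) \<phi> r) + (CLBINT r:{0..L}. F 1 \<phi> r)" for \<phi>
    unfolding vline F_def set_integral_mult_left set_integral_complex_of_real
    by (simp add: distrib_right)
  then have "g_coeff R \<mu> f n \<psi> = 1 / (2 * of_real pi) *
      (CLBINT \<phi>:{0..2 * pi}. (CLBINT r:{0..L}. F (-1) \<phi> r) + (CLBINT r:{0..L}. F 1 \<phi> r))"
    by (simp add: g_coeff_def fourier_coeff_def)
  also have "\<dots> = (CLBINT r:{0..L}. h (-1) r) + (CLBINT r:{0..L}. h 1 r)"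
    by (subst set_integral_add(2)[OF swap(1) swap(1)]) (simp add: distrib_left flip: h_eq)
  also have "\<dots> = (CLBINT r:{0..L}. h (-1) r + h 1 r)"
    by (rule set_integral_add(2)[symmetric]) (auto intro: h_int)
  also have "\<dots> = 2 * (CLBINT r:{0..L}. H r)"
    by (simp add: sum_h)
  finally show "g_coeff R \<mu> f n \<psi>
      = 2 * (CLBINT r:{0..2 * R * cos \<psi>}. chord_integrand R \<mu> f n (cos \<psi>) r)"
    by (simp add: L_def H_def)
qed

section \<open>Change of variables along the chord\<close>

text \<open>The substitution is a bijection from the open interval \<open>(0, t)\<close> onto one open half of the chord,
  with derivative \<open>\<sigma> R / (2 sqrt (t - \<rho>))\<close>. Its singularity at the midpoint of the chord, \<open>\<rho> = t\<close>, is
  harmless because the change of variables theorem for absolutely integrable functions only asks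
  for differentiability on the open interval, and it provides the integrability of the transformed
  integrand as well. For \<open>\<rho> = t\<close> the value of \<open>J\<close> is \<open>0\<close> by division by zero.\<close>

lemma half_chord_substitution:
  fixes H :: "real \<Rightarrow> 'a::euclidean_space"
  assumes R: "0 < R" and t: "0 \<le> t" and \<sigma>: "\<sigma> \<in> {-1, 1}"
    and meas [measurable]: "H \<in> borel_measurable borel"
    and int: "set_integrable lborel {0..2 * R * sqrt t} H"
  defines "J \<equiv> \<lambda>\<rho>. (R / (2 * sqrt (t - \<rho>))) *\<^sub>R H (R * (sqrt t - \<sigma> * sqrt (t - \<rho>)))"
    and "I \<equiv> if \<sigma> = 1 then {0<..<R * sqrt t} else {R * sqrt t<..<2 * R * sqrt t}"
  shows "set_integrable lborel {0..t} J"
    and "(LBINT \<rho>:{0..t}. J \<rho>) = (LBINT r:I. H r)"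
proof -
  define g where "g = (\<lambda>\<rho>. R * (sqrt t - \<sigma> * sqrt (t - \<rho>)))"
  define h where "h = (\<lambda>\<rho>. \<sigma> * R / (2 * sqrt (t - \<rho>)))"
  let ?S = "{0<..<t}"
  have deriv: "(g has_field_derivative h \<rho>) (at \<rho> within ?S)" if "\<rho> \<in> ?S" for \<rho>
    unfolding g_def h_def using that
    by (auto intro!: derivative_eq_intros simp: field_simps)
  have inj: "inj_on g ?S"
    using R \<sigma> by (intro inj_onI) (auto simp: g_def)
  have image: "g ` ?S = I"
  proof (intro set_eqI iffI)
    fix r assume "r \<in> g ` ?S"
    then obtain \<rho> where \<rho>: "0 < \<rho>" "\<rho> < t" "r = g \<rho>" by auto
    have "0 < sqrt (t - \<rho>)" "sqrt (t - \<rho>) < sqrt t" using \<rho> by auto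
    then have "0 < R * sqrt (t - \<rho>)" "R * sqrt (t - \<rho>) < R * sqrt t" using R by auto
    then show "r \<in> I" using \<sigma> \<rho> by (auto simp: I_def g_def algebra_simps)
  next
    fix r assume r: "r \<in> I"
    \<comment> \<open>\<open>u\<close> is the value of \<open>sqrt (t - \<rho>)\<close>, up to the factor \<open>R\<close> the distance from the midpoint.\<close>
    define u where "u = \<sigma> * (sqrt t - r / R)"
    have u: "0 < u" "u < sqrt t"
      using r \<sigma> R by (auto simp: u_def I_def field_simps split: if_splits)
    have u2: "u\<^sup>2 < t"
      using u t power_strict_mono[of u "sqrt t" 2] by simp
    have "g (t - u\<^sup>2) = R * (sqrt t - \<sigma> * u)"
      using u by (simp add: g_def)
    also have "\<dots> = r"
      using R \<sigma> by (auto simp: u_def field_simps)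
    finally show "r \<in> g ` ?S"
      using u u2 by (intro image_eqI[of _ _ "t - u\<^sup>2"]) auto
  qed
  have absJ: "\<bar>h \<rho>\<bar> *\<^sub>R H (g \<rho>) = J \<rho>" if "\<rho> \<in> ?S" for \<rho>
    using that \<sigma> R by (auto simp: h_def g_def J_def)
  have J_meas [measurable]: "J \<in> borel_measurable borel"
    unfolding J_def by measurable
  have I_sub: "I \<subseteq> {0..2 * R * sqrt t}" "I \<in> sets lborel"
    using R t by (auto simp: I_def field_simps split: if_splits
        intro: order_trans[OF mult_nonneg_nonneg])
  have intI: "set_integrable lborel I H"
    by (rule set_integrable_subset[OF int I_sub(2,1)])
  \<comment> \<open>The theorem used here speaks of completed Lebesgue measure; Borel measurability of \<open>H\<close> and \<open>J\<close>
    carries integrability over from Borel measure and back.\<close>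
  have "H absolutely_integrable_on g ` ?S \<and> integral (g ` ?S) H = (LBINT r:I. H r)"
    unfolding image using intI set_borel_integral_eq_integral(2)[OF intI]
    by (simp add: set_integrable_def integrable_completion)
  then have "(\<lambda>\<rho>. \<bar>h \<rho>\<bar> *\<^sub>R H (g \<rho>)) absolutely_integrable_on ?S
      \<and> integral ?S (\<lambda>\<rho>. \<bar>h \<rho>\<bar> *\<^sub>R H (g \<rho>)) = (LBINT r:I. H r)"
    by (intro iffD2[OF has_absolute_integral_change_of_variables_real] deriv inj) auto
  then have abs: "J absolutely_integrable_on ?S" and eq: "integral ?S J = (LBINT r:I. H r)"
    by (simp_all only: set_integrable_cong[OF refl refl absJ]
        Henstock_Kurzweil_Integration.integral_cong[OF absJ])
  have open_int: "set_integrable lborel ?S J"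
    using abs by (simp add: set_integrable_def integrable_completion)
  then show "set_integrable lborel {0..t} J"
    by (subst set_integrable_discrete_difference[of "{0, t}" _ ?S]) auto
  have "(LBINT \<rho>:{0..t}. J \<rho>) = (LBINT \<rho>:?S. J \<rho>)"
    by (rule set_integral_discrete_difference[of "{0, t}"]) auto
  also have "\<dots> = (LBINT r:I. H r)"
    using set_borel_integral_eq_integral(2)[OF open_int] eq by simp
  finally show "(LBINT \<rho>:{0..t}. J \<rho>) = (LBINT r:I. H r)" .
qed

lemma chord_substitution:
  fixes H :: "real \<Rightarrow> 'a::euclidean_space"
  assumes R: "0 < R" and t: "0 \<le> t"
    and meas [measurable]: "H \<in> borel_measurable borel"
    and int: "set_integrable lborel {0..2 * R * sqrt t} H"
  defines "J \<equiv> \<lambda>\<sigma> \<rho>. (R / (2 * sqrt (t - \<rho>))) *\<^sub>R H (R * (sqrt t - \<sigma> * sqrt (t - \<rho>)))"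
  shows "set_integrable lborel {0..t} (\<lambda>\<rho>. J (-1) \<rho> + J 1 \<rho>)"
    and "(LBINT \<rho>:{0..t}. J (-1) \<rho> + J 1 \<rho>) = (LBINT r:{0..2 * R * sqrt t}. H r)"
proof -
  let ?A = "{0<..<R * sqrt t}" and ?B = "{R * sqrt t<..<2 * R * sqrt t}"
  note half = half_chord_substitution[OF R t _ meas int, folded J_def]
  have J_int: "set_integrable lborel {0..t} (J \<sigma>)" if "\<sigma> \<in> {-1, 1}" for \<sigma>
    using half(1)[OF that] by (simp add: J_def)
  show "set_integrable lborel {0..t} (\<lambda>\<rho>. J (-1) \<rho> + J 1 \<rho>)"
    by (intro set_integral_add J_int) auto
  have Rt: "0 \<le> R * sqrt t" using R t by simp
  have AB: "set_integrable lborel ?A H" "set_integrable lborel ?B H"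
    using Rt by (auto intro!: set_integrable_subset[OF int])
  have "(LBINT \<rho>:{0..t}. J (-1) \<rho> + J 1 \<rho>) = (LBINT \<rho>:{0..t}. J (-1) \<rho>) + (LBINT \<rho>:{0..t}. J 1 \<rho>)"
    by (intro set_integral_add J_int) auto
  also have "\<dots> = (LBINT r:?B. H r) + (LBINT r:?A. H r)"
    using half(2)[of "-1"] half(2)[of 1] by (simp add: J_def)
  also have "\<dots> = (LBINT r:?B \<union> ?A. H r)"
    by (rule set_integral_Un[symmetric]) (use AB in auto)
  also have "\<dots> = (LBINT r:{0..2 * R * sqrt t}. H r)"
    using Rt by (intro set_integral_discrete_difference[of "{0, R * sqrt t, 2 * R * sqrt t}"]) auto
  finally show "(LBINT \<rho>:{0..t}. J (-1) \<rho> + J 1 \<rho>) = (LBINT r:{0..2 * R * sqrt t}. H r)" .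
qed

section \<open>The integrand in terms of the Chebyshev kernel\<close>

lemma f_coeff_measurable:
  fixes f :: "real ^ 2 \<Rightarrow> real"
  assumes "continuous_on UNIV f"
  shows "f_coeff f n \<in> borel_measurable borel"
proof -
  have [measurable]: "f \<in> borel_measurable borel"
    using assms by (rule borel_measurable_continuous_onI)
  show ?thesis
    unfolding f_coeff_def[abs_def] fourier_coeff_def set_lebesgue_integral_def by measurable
qed

text \<open>Outside \<open>[-1, 1]\<close> the definite description defining \<open>arccos\<close> has no witness, so it denotes the same
  unspecified constant there for all arguments. Measurability on the whole line thus follows from
  continuity on \<open>[-1, 1]\<close>.\<close>

lemma borel_measurable_arccos: "arccos \<in> borel_measurable borel"
proof -
  have outside: "arccos x = arccos 2" if "\<bar>x\<bar> > 1" for x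
  proof -
    have "cos y \<noteq> x" "cos y \<noteq> 2" for y
      using cos_le_one[of y] cos_ge_minus_one[of y] that by linarith+
    then show ?thesis by (simp add: arccos_def)
  qed
  have "continuous_on UNIV (\<lambda>x::real. arccos (max (- 1) (min 1 x)))"
    by (intro continuous_on_arccos continuous_intros) auto
  then have [measurable]: "(\<lambda>x::real. arccos (max (- 1) (min 1 x))) \<in> borel_measurable borel"
    by (rule borel_measurable_continuous_onI)
  have "arccos = (\<lambda>x::real. if \<bar>x\<bar> \<le> 1 then arccos (max (- 1) (min 1 x)) else arccos 2)"
  proof
    fix x :: real
    show "arccos x = (if \<bar>x\<bar> \<le> 1 then arccos (max (- 1) (min 1 x)) else arccos 2)"
    proof (cases "\<bar>x\<bar> \<le> 1")
      case True
      then have "max (- 1) (min 1 x) = x" by linarith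
      then show ?thesis using True by simp
    next
      case False
      then show ?thesis using outside[of x] by simp
    qed
  qed
  also have "\<dots> \<in> borel_measurable borel" by measurable
  finally show ?thesis .
qed

lemma chord_integrand_measurable:
  fixes f :: "real ^ 2 \<Rightarrow> real"
  assumes "continuous_on UNIV f"
  shows "chord_integrand R \<mu> f n s \<in> borel_measurable borel"
proof -
  note [measurable] = f_coeff_measurable[OF assms, of n] borel_measurable_arccos
  show ?thesis
    unfolding chord_integrand_def[abs_def] chord_angle_def chord_radius_def by measurable
qed

text \<open>The parity of the Chebyshev polynomials, from the reflection \<open>arccos (- z) = \<pi> - arccos z\<close>.\<close>

lemma chebyshev_T_minus:
  assumes "\<bar>z\<bar> \<le> 1"
  shows "chebyshev_T n (- z) = (- 1) powi n * chebyshev_T n z"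
proof -
  have "arccos (- z) = pi - arccos z"
    using assms by (intro arccos_minus) auto
  then have "chebyshev_T n (- z) = cos (of_int n * pi - of_int n * arccos z)"
    by (simp only: chebyshev_T_def right_diff_distrib)
  also have "\<dots> = (- 1) powi n * chebyshev_T n z"
    using cos_npi_int[of n] sin_npi_int[of n]
    by (simp add: cos_diff chebyshev_T_def mult.commute power_int_minus_left)
  finally show ?thesis .
qed

text \<open>With \<open>s = sqrt t\<close>, \<open>q = sqrt (t - \<rho>)\<close> and \<open>r = R (s - \<sigma> q)\<close> the radius is \<open>R sqrt (1 - \<rho>)\<close>, and the cosine of
  the angle is \<open>\<sigma> z\<close>, where \<open>z\<close> denotes the argument of the Chebyshev polynomial. The sign moves out by
  parity, for which \<open>\<bar>z\<bar> \<le> 1\<close> is needed; this bound comes from the identity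
  \<open>(1 - \<rho>) - (s q + \<sigma> (1 - t))\<^sup>2 = (1 - t) (q - \<sigma> s)\<^sup>2\<close>.\<close>

lemma chord_integrand_substituted:
  assumes R: "0 < R" and t: "0 \<le> \<rho>" "\<rho> \<le> t" "t \<le> 1" and \<sigma>: "\<sigma> \<in> {-1, 1}"
  shows "chord_integrand R \<mu> f n (sqrt t) (R * (sqrt t - \<sigma> * sqrt (t - \<rho>)))
    = of_real (exp (- \<mu> * R * sqrt t) * (\<sigma> powi n * exp (\<sigma> * \<mu> * R * sqrt (t - \<rho>)) *
        chebyshev_T n ((sqrt t * sqrt (t - \<rho>) + \<sigma> * (1 - t)) / sqrt (1 - \<rho>))))
      * f_coeff f n (R * sqrt (1 - \<rho>))"
proof -
  define s where "s = sqrt t"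
  define q where "q = sqrt (t - \<rho>)"
  define z where "z = (s * q + \<sigma> * (1 - t)) / sqrt (1 - \<rho>)"
  let ?r = "R * (s - \<sigma> * q)"
  have s2: "s\<^sup>2 = t" and q2: "q\<^sup>2 = t - \<rho>" and \<sigma>2: "\<sigma>\<^sup>2 = 1"
    using t \<sigma> by (auto simp: s_def q_def)
  have "R\<^sup>2 - 2 * R * s * ?r + ?r\<^sup>2 = R\<^sup>2 * (1 - s\<^sup>2 + \<sigma>\<^sup>2 * q\<^sup>2)"
    by (simp add: power2_eq_square algebra_simps)
  also have "\<dots> = R\<^sup>2 * (1 - \<rho>)"
    by (simp add: s2 q2 \<sigma>2)
  finally have radius: "chord_radius R s ?r = R * sqrt (1 - \<rho>)"
    using R by (simp add: chord_radius_def real_sqrt_mult)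
  have "R - s * ?r = R * (1 - s\<^sup>2 + \<sigma> * s * q)"
    by (simp add: power2_eq_square algebra_simps)
  also have "\<dots> = R * (\<sigma> * (s * q + \<sigma> * (1 - t)))"
    using \<sigma> by (auto simp: s2 algebra_simps)
  finally have angle: "chord_angle R s ?r = arccos (\<sigma> * z)"
    using R by (simp add: chord_angle_def radius z_def)
  have "1 - \<rho> - (s * q + \<sigma> * (1 - t))\<^sup>2 = (1 - t) * (q - \<sigma> * s)\<^sup>2"
  proof -
    have expand: "(s * q + \<sigma> * (1 - t))\<^sup>2 = s\<^sup>2 * q\<^sup>2 + 2 * \<sigma> * s * q * (1 - t) + \<sigma>\<^sup>2 * (1 - t)\<^sup>2"
      "(q - \<sigma> * s)\<^sup>2 = q\<^sup>2 - 2 * \<sigma> * s * q + \<sigma>\<^sup>2 * s\<^sup>2"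
      by (simp_all add: power2_eq_square algebra_simps)
    show ?thesis
      by (simp only: expand s2 q2 \<sigma>2) (simp add: power2_eq_square algebra_simps)
  qed
  then have "(s * q + \<sigma> * (1 - t))\<^sup>2 \<le> 1 - \<rho>"
    using t by (smt (verit) mult_nonneg_nonneg zero_le_power2)
  then have "\<bar>s * q + \<sigma> * (1 - t)\<bar> \<le> sqrt (1 - \<rho>)"
    using real_sqrt_le_mono by fastforce
  then have z: "\<bar>z\<bar> \<le> 1"
    by (auto simp: z_def divide_le_eq_1)
  have "cos (of_int n * chord_angle R s ?r) = \<sigma> powi n * chebyshev_T n z"
    using \<sigma> chebyshev_T_minus[OF z, of n] by (auto simp: angle chebyshev_T_def)
  moreover have "exp (- \<mu> * ?r) = exp (- \<mu> * R * s) * exp (\<sigma> * \<mu> * R * q)"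
    by (simp add: algebra_simps flip: exp_add)
  ultimately show ?thesis
    unfolding chord_integrand_def s_def[symmetric] q_def[symmetric] z_def[symmetric]
    by (simp only: radius mult.assoc mult.left_commute)
qed

theorem lemma2p4:
  fixes R \<mu> t :: real and f :: "real ^ 2 \<Rightarrow> real" and n :: int
  assumes "R > 0"
    and "f \<in> Cc_infinity_disc R"
    and "t \<in> {0..1}"
  shows "set_integrable lborel {0..t}
           (\<lambda>\<rho>. f_hat R f n \<rho> * of_real (K_hat R \<mu> n t \<rho> / sqrt (t - \<rho>)))
       \<and> g_hat R \<mu> f n t =
           (CLBINT \<rho>:{0..t}. f_hat R f n \<rho> * of_real (K_hat R \<mu> n t \<rho> / sqrt (t - \<rho>)))"
proof -
  have t: "0 \<le> t" "t \<le> 1" using assms(3) by auto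
  have "Ck_everywhere 0 f"
    using assms(2) unfolding Cc_infinity_disc_def smooth_def by blast
  then have cont: "continuous_on UNIV f" by simp
  have supp: "f x = 0" if "R \<le> norm x" for x
    using assms(2) that closure_subset[of "{x. f x \<noteq> 0}"]
    by (force simp: Cc_infinity_disc_def)
  define \<psi> where "\<psi> = arccos (sqrt t)"
  have "- 1 \<le> sqrt t" "sqrt t \<le> 1"
    using t real_sqrt_ge_zero[of t] by (linarith, simp)
  then have \<psi>: "0 \<le> \<psi>" "\<psi> \<le> pi" "cos \<psi> = sqrt t"
    using \<open>- 1 \<le> sqrt t\<close> \<open>sqrt t \<le> 1\<close> by (simp_all add: \<psi>_def arccos_lbound arccos_ubound)
  define H where "H = chord_integrand R \<mu> f n (sqrt t)"
  have H_int: "set_integrable lborel {0..2 * R * sqrt t} H"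
    and g_eq: "g_coeff R \<mu> f n \<psi> = 2 * (CLBINT r:{0..2 * R * sqrt t}. H r)"
    unfolding H_def \<psi>(3)[symmetric]
    by (rule g_coeff_eq_chord_integral[OF less_imp_le[OF assms(1)] cont _ \<psi>(1,2)], erule supp)+
  define J where "J = (\<lambda>\<sigma> \<rho>. (R / (2 * sqrt (t - \<rho>))) *\<^sub>R H (R * (sqrt t - \<sigma> * sqrt (t - \<rho>))))"
  define G where "G = (\<lambda>\<rho>. f_hat R f n \<rho> * of_real (K_hat R \<mu> n t \<rho> / sqrt (t - \<rho>)))"
  have H_meas: "H \<in> borel_measurable borel"
    unfolding H_def by (rule chord_integrand_measurable[OF cont])
  note J = chord_substitution[OF assms(1) t(1) H_meas H_int, folded J_def]
  have J_int: "set_integrable lborel {0..t} (\<lambda>\<rho>. J (-1) \<rho> + J 1 \<rho>)"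
    and J_eq: "(CLBINT \<rho>:{0..t}. J (-1) \<rho> + J 1 \<rho>) = (CLBINT r:{0..2 * R * sqrt t}. H r)"
    using J by (simp_all add: J_def)
  \<comment> \<open>The exponential prefactor of \<open>g_hat\<close> cancels the attenuation \<open>exp (- \<mu> R s)\<close> up to the midpoint
    of the chord. At \<open>\<rho> = t\<close> both sides vanish by division by zero.\<close>
  have GJ: "G \<rho> = of_real (exp (\<mu> * R * sqrt t)) * (J (-1) \<rho> + J 1 \<rho>)" if \<rho>: "\<rho> \<in> {0..t}" for \<rho>
  proof -
    define k where "k = (\<lambda>\<sigma>. \<sigma> powi n * exp (\<sigma> * \<mu> * R * sqrt (t - \<rho>)) *
        chebyshev_T n ((sqrt t * sqrt (t - \<rho>) + \<sigma> * (1 - t)) / sqrt (1 - \<rho>)))"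
    let ?f = "f_coeff f n (R * sqrt (1 - \<rho>))"
    have H_eq: "H (R * (sqrt t - \<sigma> * sqrt (t - \<rho>))) = of_real (exp (- \<mu> * R * sqrt t) * k \<sigma>) * ?f"
      if "\<sigma> \<in> {-1, 1}" for \<sigma>
      unfolding H_def k_def using \<rho> t by (intro chord_integrand_substituted assms(1) that) auto
    have J_eq: "J \<sigma> \<rho> = of_real (exp (- \<mu> * R * sqrt t) * (R / (2 * sqrt (t - \<rho>)) * k \<sigma>)) * ?f"
      if "\<sigma> \<in> {-1, 1}" for \<sigma>
      unfolding J_def H_eq[OF that] by (simp add: scaleR_conv_of_real)
    have "G \<rho> = of_real (R / (2 * sqrt (t - \<rho>)) * (k (-1) + k 1)) * ?f"
      by (simp add: G_def f_hat_def K_hat_def k_def)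
    also have "R / (2 * sqrt (t - \<rho>)) * (k (-1) + k 1)
        = exp (\<mu> * R * sqrt t) * exp (- \<mu> * R * sqrt t) * (R / (2 * sqrt (t - \<rho>)) * (k (-1) + k 1))"
      by (simp flip: exp_add)
    finally show ?thesis
      by (simp add: J_eq algebra_simps add_divide_distrib)
  qed
  have "set_integrable lborel {0..t} (\<lambda>\<rho>. of_real (exp (\<mu> * R * sqrt t)) * (J (-1) \<rho> + J 1 \<rho>))"
    using J_int by (intro set_integrable_mult_right)
  then have "set_integrable lborel {0..t} G"
    by (simp only: set_integrable_cong[OF refl refl GJ])
  moreover have "g_hat R \<mu> f n t = (CLBINT \<rho>:{0..t}. G \<rho>)"
  proof -
    have "g_hat R \<mu> f n t = of_real (exp (\<mu> * R * sqrt t)) * (CLBINT r:{0..2 * R * sqrt t}. H r)"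
      using g_eq by (simp add: g_hat_def \<psi>_def)
    also have "\<dots> = (CLBINT \<rho>:{0..t}. of_real (exp (\<mu> * R * sqrt t)) * (J (-1) \<rho> + J 1 \<rho>))"
      by (simp only: set_integral_mult_right J_eq)
    also have "\<dots> = (CLBINT \<rho>:{0..t}. G \<rho>)"
      using GJ by (intro set_lebesgue_integral_cong) auto
    finally show ?thesis .
  qed
  ultimately show ?thesis by (simp add: G_def)
qed

end
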